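(* Let $N\ge 1$ be an integer and let $f:[0,+\infty)\to\mathbb{R}$ be locally Lipschitz-continuous and such that: (i) there is $\mu>0$ with $f>0$ on $(0,\mu)$ and $f\le 0$ on $[\mu,+\infty)$; (ii) there is $\mu'\in(0,\mu)$ such that $f$ is nonincreasing on $[\mu',\mu]$; (iii) either $f(0)>0$, or [$f(0)=0$ and $\liminf_{s\to 0^+} f(s)/s>0$]; (iv) $\displaystyle\liminf_{s\to z^-}\frac{f(s)}{s-z}>0$ for all $z>\mu$ such that $f(z)=0$. Then any bounded nonnegative solution $u$ of $$\Delta u+f(u)=0\quad\text{in }\mathbb{R}^N$$ is constant.
   Context: Solutions are classical, i.e. $u\in C^2(\mathbb{R}^N)$. *)

theory Defs
  imports "HOL-Analysis.Analysis"
begin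

(* The library's local_lipschitz is for time-dependent families; a single function is
   the constant family, so only the one-point time set {0} is needed. *)
definition locally_lipschitz_on :: "'a::metric_space set \<Rightarrow> ('a \<Rightarrow> 'b::metric_space) \<Rightarrow> bool"
  where "locally_lipschitz_on S f \<longleftrightarrow> local_lipschitz {0::real} S (\<lambda>_. f)"

(* Meaningful where v is differentiable, which C2 below guarantees for u and for its
   first-order partial derivatives. *)
definition partial :: "'n::finite \<Rightarrow> (real^'n \<Rightarrow> real) \<Rightarrow> real^'n \<Rightarrow> real"
  where "partial i v x = frechet_derivative v (at x) (axis i 1)"

definition C1 :: "(real^'n::finite \<Rightarrow> real) \<Rightarrow> bool"
  where "C1 v \<longleftrightarrow> (\<forall>x. v differentiable (at x)) \<and> (\<forall>i. continuous_on UNIV (partial i v))"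

definition C2 :: "(real^'n::finite \<Rightarrow> real) \<Rightarrow> bool"
  where "C2 v \<longleftrightarrow> C1 v \<and> (\<forall>i. C1 (partial i v))"

definition laplacian :: "(real^'n::finite \<Rightarrow> real) \<Rightarrow> real^'n \<Rightarrow> real"
  where "laplacian v x = (\<Sum>i\<in>UNIV. partial i (partial i v) x)"

end

theory Submission
  imports Defs
begin

text \<open>A nonnegative \<open>w\<close> that satisfies \<open>\<Delta>w \<le> -c w\<close> wherever \<open>w < \<delta>\<close> either vanishes identically
  or is at least \<open>\<delta>\<close> everywhere: by the strong maximum principle a zero propagates, and a
  positive \<open>w\<close> is compared with a bump on a ball so large that the bump is a strict subsolution.
  By (iii) this applies to \<open>u\<close>, so \<open>u = 0\<close> or \<open>m = inf u > 0\<close>. Evaluating the equation at almost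
  minimal and almost maximal points gives \<open>f m \<le> 0\<close> and \<open>f M \<ge> 0\<close> for \<open>M = sup u\<close>. The first
  yields \<open>m \<ge> \<mu>\<close> by (i). If \<open>M > \<mu>\<close>, the second makes \<open>M\<close> a zero of \<open>f\<close>, and by (iv) the
  dichotomy applies to \<open>M - u\<close>, whose infimum is \<open>0\<close>.\<close>

section \<open>Second derivatives along lines and a pointwise Laplacian\<close>

text \<open>A relation, not an operator: the maximum principles only need calculus on coordinate
  lines. Bumps and barriers can thus be combined with \<open>u\<close> without a proof that they are
  \<open>C2\<close>.\<close>

definition has_second_along :: "(real^'n::finite \<Rightarrow> real) \<Rightarrow> real^'n \<Rightarrow> real^'n \<Rightarrow> real \<Rightarrow> bool"
  where "has_second_along v e y d \<longleftrightarrow>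
    (\<exists>v'. (\<forall>s. ((\<lambda>s. v (y + s *\<^sub>R e)) has_real_derivative v' s) (at s)) \<and>
          (v' has_real_derivative d) (at 0))"

definition has_laplacian :: "(real^'n::finite \<Rightarrow> real) \<Rightarrow> real^'n \<Rightarrow> real \<Rightarrow> bool"
  where "has_laplacian v y l \<longleftrightarrow>
    (\<exists>d. (\<forall>i. has_second_along v (axis i 1) y (d i)) \<and> l = (\<Sum>i\<in>UNIV. d i))"

lemma has_second_along_linear:
  assumes "has_second_along v e y a" "has_second_along w e y b"
  shows "has_second_along (\<lambda>x. k * v x + m * w x) e y (k * a + m * b)"
proof -
  obtain v' w' where
    "\<And>s. ((\<lambda>s. v (y + s *\<^sub>R e)) has_real_derivative v' s) (at s)" "(v' has_real_derivative a) (at 0)"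
    "\<And>s. ((\<lambda>s. w (y + s *\<^sub>R e)) has_real_derivative w' s) (at s)" "(w' has_real_derivative b) (at 0)"
    using assms unfolding has_second_along_def by blast
  then show ?thesis
    unfolding has_second_along_def
    by (intro exI[of _ "\<lambda>s. k * v' s + m * w' s"] conjI allI DERIV_add DERIV_cmult)
qed

lemma has_laplacian_linear:
  assumes "has_laplacian v y a" "has_laplacian w y b"
  shows "has_laplacian (\<lambda>x. k * v x + m * w x) y (k * a + m * b)"
proof -
  obtain d d' where "\<And>i. has_second_along v (axis i 1) y (d i)" "a = (\<Sum>i\<in>UNIV. d i)"
    "\<And>i. has_second_along w (axis i 1) y (d' i)" "b = (\<Sum>i\<in>UNIV. d' i)"
    using assms unfolding has_laplacian_def by blast
  then show ?thesis
    unfolding has_laplacian_def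
    by (intro exI[of _ "\<lambda>i. k * d i + m * d' i"])
      (auto simp: sum.distrib sum_distrib_left intro: has_second_along_linear)
qed

lemma has_laplacian_const: "has_laplacian (\<lambda>x. k) y 0"
  unfolding has_laplacian_def has_second_along_def
  by (rule exI[of _ "\<lambda>_. 0"]) (auto intro!: exI[of _ "\<lambda>_. 0"])

lemma partial_has_derivative_along:
  assumes "C1 v"
  shows "((\<lambda>s. v (y + s *\<^sub>R axis i 1)) has_real_derivative partial i v (y + s *\<^sub>R axis i 1)) (at s)"
proof -
  let ?D = "frechet_derivative v (at (y + s *\<^sub>R axis i 1))"
  have D: "(v has_derivative ?D) (at (y + s *\<^sub>R axis i 1))"
    using assms frechet_derivative_works unfolding C1_def by blast
  have "((\<lambda>s. v (y + s *\<^sub>R axis i 1)) has_derivative (\<lambda>h. ?D (h *\<^sub>R axis i 1))) (at s)"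
    by (rule has_derivative_compose[where g = v and f = "\<lambda>s. y + s *\<^sub>R axis i 1", OF _ D])
      (auto intro!: derivative_eq_intros)
  moreover have "?D (h *\<^sub>R axis i 1) = h * ?D (axis i 1)" for h
    using linear_scale[OF has_derivative_linear[OF D]] by simp
  ultimately show ?thesis
    unfolding has_field_derivative_def partial_def by (simp add: mult_commute_abs)
qed

lemma C2_has_laplacian:
  assumes "C2 v"
  shows "has_laplacian v y (laplacian v y)"
proof -
  have "has_second_along v (axis i 1) y (partial i (partial i v) y)" for i
    using assms partial_has_derivative_along[of v y i]
      partial_has_derivative_along[of "partial i v" y i 0]
    unfolding C2_def has_second_along_def
    by (intro exI[of _ "\<lambda>s. partial i v (y + s *\<^sub>R axis i 1)"]) auto
  then show ?thesis
    unfolding has_laplacian_def laplacian_def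
    by (intro exI[of _ "\<lambda>i. partial i (partial i v) y"]) auto
qed

lemma inner_diff_eq_dist_sq: "(y - x) \<bullet> (y - x) = (dist x y)\<^sup>2"
  by (metis dist_commute dist_norm power2_norm_eq_inner)

text \<open>Here \<open>r\<close> is the squared distance, so the profile \<open>P\<close> causes no
  singularity at the centre. On the i-th coordinate line the argument of \<open>P\<close> is a
  quadratic in \<open>s\<close>; its second derivative at 0 contributes 4 z_i^2 P'' + 2 P', and the
  z_i^2 sum to \<open>r\<close>.\<close>

lemma has_laplacian_radial:
  fixes x0 y :: "real^'n::finite"
  assumes P: "\<And>q. (P has_real_derivative P' q) (at q)"
    and P': "\<And>q. (P' has_real_derivative P'' q) (at q)"
  defines "r \<equiv> (y - x0) \<bullet> (y - x0)"
  shows "has_laplacian (\<lambda>x. P ((x - x0) \<bullet> (x - x0))) y (4 * r * P'' r + 2 * real CARD('n) * P' r)"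
proof -
  define z where "z = y - x0"
  have q: "(y + s *\<^sub>R axis i 1 - x0) \<bullet> (y + s *\<^sub>R axis i 1 - x0) = r + 2 * s * z $ i + s\<^sup>2" for s i
  proof -
    have "y + s *\<^sub>R axis i 1 - x0 = z + s *\<^sub>R axis i 1"
      by (simp add: z_def)
    then show ?thesis
      by (simp add: inner_add_left inner_add_right inner_axis inner_axis' inner_commute
          inner_axis_axis r_def z_def power2_eq_square algebra_simps)
  qed
  have "has_second_along (\<lambda>x. P ((x - x0) \<bullet> (x - x0))) (axis i 1) y
      (P'' r * 4 * (z $ i)\<^sup>2 + 2 * P' r)" for i
    unfolding has_second_along_def q
  proof (intro exI conjI allI)
    show "((\<lambda>s. P (r + 2 * s * z $ i + s\<^sup>2)) has_real_derivative
        P' (r + 2 * s * z $ i + s\<^sup>2) * (2 * z $ i + 2 * s)) (at s)" for s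
      by (rule DERIV_chain2[OF P]) (auto intro!: derivative_eq_intros)
    have "((\<lambda>s. P' (r + 2 * s * z $ i + s\<^sup>2)) has_real_derivative
        P'' (r + 2 * 0 * z $ i + 0\<^sup>2) * (2 * z $ i)) (at 0)"
      by (rule DERIV_chain2[OF P']) (auto intro!: derivative_eq_intros)
    then show "((\<lambda>s. P' (r + 2 * s * z $ i + s\<^sup>2) * (2 * z $ i + 2 * s)) has_real_derivative
        P'' r * 4 * (z $ i)\<^sup>2 + 2 * P' r) (at 0)"
      by (auto intro!: derivative_eq_intros simp: power2_eq_square algebra_simps)
  qed
  moreover have "(\<Sum>i\<in>UNIV. P'' r * 4 * (z $ i)\<^sup>2 + 2 * P' r)
      = 4 * r * P'' r + 2 * real CARD('n) * P' r"
  proof -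
    have "r = (\<Sum>i\<in>UNIV. (z $ i)\<^sup>2)"
      by (simp add: r_def z_def inner_vec_def power2_eq_square)
    moreover have "(\<Sum>i\<in>UNIV. P'' r * 4 * (z $ i)\<^sup>2) = P'' r * 4 * (\<Sum>i\<in>UNIV. (z $ i)\<^sup>2)"
      by (rule sum_distrib_left[symmetric])
    ultimately show ?thesis
      by (simp add: sum.distrib)
  qed
  ultimately show ?thesis
    unfolding has_laplacian_def
    by (intro exI[of _ "\<lambda>i. P'' r * 4 * (z $ i)\<^sup>2 + 2 * P' r"]) simp
qed

section \<open>The Laplacian at minima and almost minima\<close>

text \<open>If \<open>d\<close> were negative, \<open>g'\<close>, which vanishes at the minimum,
  would be negative just to the right of 0, and \<open>g\<close> would drop below
  \<open>g 0\<close>.\<close>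

lemma second_derivative_nonneg_at_min:
  fixes g :: "real \<Rightarrow> real"
  assumes g: "\<And>s. (g has_real_derivative g' s) (at s)" and g': "(g' has_real_derivative d) (at 0)"
    and "r > 0" and min: "\<And>s. \<bar>s\<bar> < r \<Longrightarrow> g 0 \<le> g s"
  shows "d \<ge> 0"
proof (rule ccontr)
  assume "\<not> d \<ge> 0"
  then obtain e where e: "e > 0" "\<And>h. 0 < h \<Longrightarrow> h < e \<Longrightarrow> g' 0 > g' h"
    using DERIV_neg_dec_right[OF g'] by auto
  have z: "g' 0 = 0"
    using DERIV_local_min[OF g \<open>r > 0\<close>, of 0] min by auto
  define h where "h = min e r / 2"
  have h: "0 < h" "h < e" "h < r"
    using e(1) \<open>r > 0\<close> by (auto simp: h_def)
  have "g h < g 0"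
  proof (rule DERIV_neg_imp_decreasing_open[OF h(1)])
    show "\<exists>y. (g has_real_derivative y) (at x) \<and> y < 0" if "0 < x" "x < h" for x
      using g e(2)[of x] that h z by auto
    show "continuous_on {0..h} g"
      using g by (meson DERIV_isCont continuous_at_imp_continuous_on)
  qed
  then show False
    using min[of h] h by simp
qed

lemma has_laplacian_nonneg_at_min:
  assumes "has_laplacian v y l" and "r > 0" and min: "\<And>x. dist y x < r \<Longrightarrow> v y \<le> v x"
  shows "l \<ge> 0"
proof -
  obtain d where d: "\<And>i. has_second_along v (axis i 1) y (d i)" and l: "l = (\<Sum>i\<in>UNIV. d i)"
    using assms(1) unfolding has_laplacian_def by blast
  have "d i \<ge> 0" for i
  proof -
    obtain v' where "\<And>s. ((\<lambda>s. v (y + s *\<^sub>R axis i 1)) has_real_derivative v' s) (at s)"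
      "(v' has_real_derivative d i) (at 0)"
      using d unfolding has_second_along_def by blast
    then show ?thesis
      by (rule second_derivative_nonneg_at_min[OF _ _ \<open>r > 0\<close>])
        (auto intro!: min simp: dist_norm)
  qed
  then show ?thesis
    using l by (simp add: sum_nonneg)
qed

text \<open>The infimum need not be attained; adding a small multiple of \<open>|x - x0|\<^sup>2\<close>, with \<open>x0\<close>
  almost minimal, forces a minimum inside the unit ball around \<open>x0\<close>.\<close>

lemma almost_minimum_laplacian:
  fixes w :: "real^'n::finite \<Rightarrow> real"
  assumes cont: "continuous_on UNIV w" and lap: "\<And>x. has_laplacian w x (l x)"
    and bdd: "bdd_below (range w)" and "\<epsilon> > 0"
  obtains y where "w y < Inf (range w) + \<epsilon>" "l y \<ge> - \<epsilon>"
proof -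
  define m where "m = Inf (range w)"
  have m: "m \<le> w x" for x
    unfolding m_def using bdd by (simp add: cInf_lower)
  \<comment> \<open>The penalty then has Laplacian 2 N \<eta> \<le> \<epsilon>, with N the
    dimension, and also \<eta> \<le> \<epsilon>.\<close>
  define \<eta> where "\<eta> = \<epsilon> / (2 * real CARD('n) + 1)"
  have \<eta>: "\<eta> > 0" "2 * real CARD('n) * \<eta> \<le> \<epsilon>" "\<eta> \<le> \<epsilon>"
    using \<open>\<epsilon> > 0\<close> by (auto simp: \<eta>_def field_simps)
  obtain x0 where x0: "w x0 < m + \<eta>"
    using cInf_lessD[of "range w" "m + \<eta>"] \<eta>(1) by (auto simp: m_def)
  define v where "v = (\<lambda>x. 1 * w x + \<eta> * ((x - x0) \<bullet> (x - x0)))"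
  have "continuous_on (cball x0 1) v"
    unfolding v_def by (intro continuous_intros continuous_on_subset[OF cont]) auto
  then obtain y where y: "dist x0 y \<le> 1" and min: "\<And>x. dist x0 x \<le> 1 \<Longrightarrow> v y \<le> v x"
    using continuous_attains_inf[OF compact_cball, of x0 1 v] by auto
  have vy: "v y < m + \<eta>"
    using min[of x0] x0 by (simp add: v_def)
  \<comment> \<open>On the unit sphere the penalty equals \<eta>, so \<open>v\<close> is at least
    \<open>m + \<eta>\<close> there, which exceeds \<open>v x0\<close>.\<close>
  have "dist x0 y \<noteq> 1"
    using vy m[of y] unfolding v_def inner_diff_eq_dist_sq by auto
  then have r: "1 - dist x0 y > 0"
    using y by simp
  have "has_laplacian v y (1 * l y + \<eta> * (4 * ((y - x0) \<bullet> (y - x0)) * 0 + 2 * real CARD('n) * 1))"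
    unfolding v_def
    by (intro has_laplacian_linear lap has_laplacian_radial[where P = "\<lambda>q. q" and P' = "\<lambda>_. 1" and P'' = "\<lambda>_. 0"])
      (auto intro!: derivative_eq_intros)
  then have "1 * l y + \<eta> * (4 * ((y - x0) \<bullet> (y - x0)) * 0 + 2 * real CARD('n) * 1) \<ge> 0"
    by (rule has_laplacian_nonneg_at_min[OF _ r])
      (metis min dist_triangle_le add.commute le_diff_eq less_imp_le dist_commute)
  then have "l y \<ge> - \<epsilon>"
    using \<eta>(2) by (simp add: algebra_simps)
  moreover have "w y < m + \<epsilon>"
  proof -
    have "\<eta> * ((y - x0) \<bullet> (y - x0)) \<ge> 0"
      using \<eta>(1) by simp
    then show ?thesis
      using vy \<eta>(3) unfolding v_def by linarith
  qed
  ultimately show thesis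
    using that unfolding m_def by blast
qed

section \<open>Lower bound for positive supersolutions\<close>

text \<open>Compare with \<open>(1 - b |x - x0|\<^sup>2)\<^sup>2\<close>: for this choice of \<open>b\<close> its Laplacian exceeds
  \<open>-c\<close> times itself, so a largest multiple lying below \<open>w\<close> cannot touch \<open>w\<close> where \<open>w < \<delta>\<close>.\<close>

lemma positive_supersolution_lower_bound:
  fixes w :: "real^'n::finite \<Rightarrow> real"
  assumes cont: "continuous_on UNIV w" and lap: "\<And>x. has_laplacian w x (l x)"
    and pos: "\<And>x. w x > 0" and "c > 0" and super: "\<And>x. w x < \<delta> \<Longrightarrow> l x \<le> - c * w x"
  shows "w x0 \<ge> \<delta>"
proof (rule ccontr)
  assume "\<not> w x0 \<ge> \<delta>"
  define k where "k = real CARD('n) + 2"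
  have "k > 0"
    by (simp add: k_def)
  \<comment> \<open>This value turns \<open>c * s\<^sup>2 + L\<close> at the end into b ((k s - 2)^2
    + 4), a completed square plus a positive constant. \<open>R\<close> is the radius at which the
    bump vanishes.\<close>
  define b where "b = c / k\<^sup>2"
  have "b > 0"
    using \<open>c > 0\<close> \<open>k > 0\<close> by (simp add: b_def)
  define R where "R = 1 / sqrt b"
  have R: "R > 0" "b * R\<^sup>2 = 1"
    using \<open>b > 0\<close> by (auto simp: R_def power_divide)
  define P where "P = (\<lambda>q. (1 - b * q)\<^sup>2)"
  define \<phi> where "\<phi> = (\<lambda>x. P ((x - x0) \<bullet> (x - x0)))"
  have "continuous_on (cball x0 R) (\<lambda>x. \<phi> x / w x)"
    unfolding \<phi>_def P_def using pos
    by (intro continuous_intros continuous_on_subset[OF cont]) (auto simp: less_imp_neq[symmetric])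
  \<comment> \<open>Maximising the quotient finds the contact directly: with \<open>K\<close> its
    maximum, \<open>K * w - \<phi>\<close> is nonnegative on the ball and zero at
    \<open>y\<close>.\<close>
  then obtain y where y: "dist x0 y \<le> R"
    and max: "\<And>x. dist x0 x \<le> R \<Longrightarrow> \<phi> x / w x \<le> \<phi> y / w y"
    using continuous_attains_sup[OF compact_cball, of x0 R "\<lambda>x. \<phi> x / w x"] R(1) by auto
  define K where "K = \<phi> y / w y"
  have K: "1 / w x0 \<le> K"
    using max[of x0] R(1) by (simp add: K_def \<phi>_def P_def)
  then have "K > 0"
    using pos[of x0] by (smt (verit) divide_pos_pos)
  have \<phi>y: "\<phi> y = K * w y"
    using pos[of y] by (simp add: K_def)
  define s where "s = 1 - b * ((y - x0) \<bullet> (y - x0))"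
  have \<phi>s: "\<phi> y = s\<^sup>2"
    by (simp add: \<phi>_def P_def s_def)
  \<comment> \<open>The bump vanishes on the boundary sphere, whereas
    \<open>\<phi> y = K * w y\<close> is positive; so the contact is interior.\<close>
  have "s \<noteq> 0"
    using \<phi>s \<phi>y \<open>K > 0\<close> pos[of y] by auto
  moreover have "b * (dist x0 y)\<^sup>2 \<le> b * R\<^sup>2"
    using y \<open>b > 0\<close> by (intro mult_left_mono power_mono) auto
  ultimately have s: "0 < s" "s \<le> 1"
    using R(2) \<open>b > 0\<close> by (auto simp: s_def inner_diff_eq_dist_sq)
  have "dist x0 y \<noteq> R"
    using \<open>s \<noteq> 0\<close> R(2) by (auto simp: s_def inner_diff_eq_dist_sq)
  then have r: "R - dist x0 y > 0"
    using y by simp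
  \<comment> \<open>The bump is 1 at the centre and at most 1 on the ball, so
    \<open>w y \<le> w x0 < \<delta>\<close>: the contact lies where \<open>super\<close>
    applies.\<close>
  have wy: "w y < \<delta>"
  proof -
    have "1 / w x0 * w y \<le> \<phi> y"
      unfolding \<phi>y using K pos[of y] by (intro mult_right_mono) auto
    also have "\<dots> \<le> 1"
      using s by (simp add: \<phi>s power_le_one)
    finally show ?thesis
      using \<open>\<not> w x0 \<ge> \<delta>\<close> pos[of x0] by (simp add: field_simps)
  qed
  define q where "q = (y - x0) \<bullet> (y - x0)"
  define L where "L = 4 * q * (2 * b\<^sup>2) + 2 * real CARD('n) * (- 2 * b * (1 - b * q))"
  have "has_laplacian (\<lambda>x. K * w x + (-1) * \<phi> x) y
      (K * l y + (-1) * L)"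
    unfolding \<phi>_def L_def q_def
    by (intro has_laplacian_linear lap has_laplacian_radial[where P' = "\<lambda>q. - 2 * b * (1 - b * q)" and P'' = "\<lambda>_. 2 * b\<^sup>2"])
      (auto intro!: derivative_eq_intros simp: P_def power2_eq_square algebra_simps)
  then have "K * l y + (-1) * L \<ge> 0"
  proof (rule has_laplacian_nonneg_at_min[OF _ r])
    fix x
    assume "dist y x < R - dist x0 y"
    then have "dist x0 x \<le> R"
      using dist_triangle[of x0 x y] by simp
    then have "\<phi> x / w x \<le> K"
      using max by (simp add: K_def)
    then have "\<phi> x \<le> K * w x"
      using pos[of x] by (simp add: pos_divide_le_eq)
    then show "K * w y + (-1) * \<phi> y \<le> K * w x + (-1) * \<phi> x"
      using \<phi>y by simp
  qed
  then have "L \<le> K * l y"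
    by simp
  also have "K * l y \<le> - (c * s\<^sup>2)"
    using super[OF wy] \<open>K > 0\<close> \<phi>y \<phi>s mult_left_mono[of "l y" "- c * w y" K] by (simp add: algebra_simps)
  finally have "c * s\<^sup>2 + L \<le> 0"
    by simp
  moreover have "L = b * (8 * (1 - s) - 4 * (k - 2) * s)"
    by (simp add: L_def s_def q_def k_def power2_eq_square algebra_simps)
  moreover have "c * s\<^sup>2 + b * (8 * (1 - s) - 4 * (k - 2) * s) = b * ((k * s - 2)\<^sup>2 + 4)"
  proof -
    have "c = b * k\<^sup>2"
      using \<open>k > 0\<close> by (simp add: b_def)
    then show ?thesis
      by (simp add: power2_eq_square algebra_simps)
  qed
  moreover have "b * ((k * s - 2)\<^sup>2 + 4) > 0"
    using \<open>b > 0\<close> by (intro mult_pos_pos add_nonneg_pos) auto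
  ultimately show False
    by simp
qed

section \<open>The strong minimum principle\<close>

text \<open>Hopf's barrier, with the boundary point lemma avoided: the barrier vanishes at the
  contact point \<open>p\<close>, and the comparison is made on a ball centred at \<open>p\<close>.\<close>

lemma no_isolated_contact:
  fixes w :: "real^'n::finite \<Rightarrow> real"
  assumes cont: "continuous_on UNIV w" and lap: "\<And>x. has_laplacian w x (l x)"
    and nonneg: "\<And>x. w x \<ge> 0" and "w p = 0" and \<rho>: "0 < \<rho>" "\<rho> < dist z p"
    and super: "\<And>x. dist p x \<le> \<rho> \<Longrightarrow> l x \<le> 0"
    and pos: "\<And>x. dist z x \<le> dist z p \<Longrightarrow> x \<noteq> p \<Longrightarrow> w x > 0"
  shows False
proof -
  define R where "R = dist z p"
  \<comment> \<open>Within \<rho> of \<open>p\<close> the distance to \<open>z\<close> is at least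
    \<open>R - \<rho>\<close>, so \<alpha> q is at least the dimension N. The factor 4 \<alpha> q -
    2 N in the Laplacian of \<open>h\<close> is then positive.\<close>
  define \<alpha> where "\<alpha> = real CARD('n) / (R - \<rho>)\<^sup>2"
  have "\<alpha> > 0"
    using \<rho> by (simp add: \<alpha>_def R_def)
  define h where "h = (\<lambda>x. exp (- \<alpha> * ((x - z) \<bullet> (x - z))) - exp (- \<alpha> * R\<^sup>2))"
  have conth: "continuous_on S h" for S
    unfolding h_def by (intro continuous_intros)
  have lap_h: "\<exists>a>0. has_laplacian h x a" if "dist p x \<le> \<rho>" for x
  proof -
    define q where "q = (x - z) \<bullet> (x - z)"
    let ?a = "4 * q * (\<alpha>\<^sup>2 * exp (- \<alpha> * q)) + 2 * real CARD('n) * (- \<alpha> * exp (- \<alpha> * q))"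
    have "R - \<rho> \<le> dist z x"
      using dist_triangle[of z p x] that by (simp add: R_def dist_commute)
    then have "(R - \<rho>)\<^sup>2 \<le> q"
      using \<rho> unfolding q_def inner_diff_eq_dist_sq R_def by (intro power_mono) auto
    then have "\<alpha> * q \<ge> real CARD('n)"
      using \<rho> by (simp add: \<alpha>_def R_def field_simps)
    then have "4 * (\<alpha> * q) - 2 * real CARD('n) > 0"
      by (smt (verit) of_nat_0_less_iff zero_less_card_finite)
    then have "\<alpha> * exp (- \<alpha> * q) * (4 * (\<alpha> * q) - 2 * real CARD('n)) > 0"
      using \<open>\<alpha> > 0\<close> by simp
    then have "?a > 0"
      by (simp add: power2_eq_square algebra_simps)
    moreover have "has_laplacian h x ?a"
      unfolding h_def q_def
      by (rule has_laplacian_radial[where P = "\<lambda>q. exp (- \<alpha> * q) - exp (- \<alpha> * R\<^sup>2)"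
            and P' = "\<lambda>q. - \<alpha> * exp (- \<alpha> * q)" and P'' = "\<lambda>q. \<alpha>\<^sup>2 * exp (- \<alpha> * q)"])
        (auto intro!: derivative_eq_intros simp: power2_eq_square)
    ultimately show ?thesis
      by blast
  qed
  \<comment> \<open>The part of the sphere in \<open>cball z R\<close> is compact and misses
    \<open>p\<close>, so \<open>w\<close> has a positive lower bound there, while
    \<open>h \<le> 1\<close>. On the rest \<open>h \<le> 0 \<le> w\<close>.\<close>
  obtain \<epsilon> where \<epsilon>: "\<epsilon> > 0" "\<And>x. dist p x = \<rho> \<Longrightarrow> \<epsilon> * h x \<le> w x"
  proof -
    define S where "S = sphere p \<rho> \<inter> cball z R"
    have "compact S"
      unfolding S_def by (intro compact_Int_closed) auto
    obtain m where m: "m > 0" "\<And>x. x \<in> S \<Longrightarrow> m \<le> w x"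
    proof (cases "S = {}")
      case False
      then obtain x1 where x1: "x1 \<in> S" "\<And>x. x \<in> S \<Longrightarrow> w x1 \<le> w x"
        using continuous_attains_inf[OF \<open>compact S\<close> False continuous_on_subset[OF cont]] by auto
      moreover have "w x1 > 0"
        using x1(1) \<rho> by (intro pos) (auto simp: S_def R_def)
      ultimately show thesis
        using that by blast
    qed (auto intro: that[of 1])
    have "m * h x \<le> w x" if "dist p x = \<rho>" for x
    proof (cases "dist z x \<le> R")
      case True
      have "h x \<le> exp (- \<alpha> * ((x - z) \<bullet> (x - z)))"
        by (simp add: h_def)
      also have "\<dots> \<le> 1"
        using \<open>\<alpha> > 0\<close> by simp
      finally have "m * h x \<le> m"
        using m(1) by simp
      also have "\<dots> \<le> w x"
        using True that by (intro m) (auto simp: S_def)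
      finally show ?thesis .
    next
      case False
      then have "R\<^sup>2 \<le> (dist z x)\<^sup>2"
        by (intro power_mono) (auto simp: R_def)
      then have "h x \<le> 0"
        using \<open>\<alpha> > 0\<close> by (simp add: h_def inner_diff_eq_dist_sq)
      then have "m * h x \<le> 0"
        using m(1) by (simp add: mult_le_0_iff)
      then show ?thesis
        using nonneg[of x] by linarith
    qed
    then show thesis
      using that m(1) by blast
  qed
  define v where "v = (\<lambda>x. 1 * w x + (- \<epsilon>) * h x)"
  have "v p = 0"
    by (simp add: v_def h_def inner_diff_eq_dist_sq R_def \<open>w p = 0\<close>)
  \<comment> \<open>At an interior minimum the Laplacian of \<open>v\<close> would be nonnegative,
    but it is \<open>l y\<close> minus a positive number, with \<open>l y \<le> 0\<close>.\<close>
  have interior: False if y: "dist p y < \<rho>" and min: "\<And>x. dist p x \<le> \<rho> \<Longrightarrow> v y \<le> v x" for y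
  proof -
    obtain a where a: "a > 0" "has_laplacian h y a"
      using lap_h[of y] y by (meson less_imp_le)
    have "has_laplacian v y (1 * l y + (- \<epsilon>) * a)"
      unfolding v_def by (intro has_laplacian_linear lap a)
    moreover have "v y \<le> v x" if "dist y x < \<rho> - dist p y" for x
      using that dist_triangle[of p x y] by (intro min) simp
    ultimately have "1 * l y + (- \<epsilon>) * a \<ge> 0"
      using y by (intro has_laplacian_nonneg_at_min[of v y _ "\<rho> - dist p y"]) auto
    then show False
      using super[of y] y mult_pos_pos[OF \<epsilon>(1) a(1)] by linarith
  qed
  have "continuous_on (cball p \<rho>) v"
    unfolding v_def by (intro continuous_intros conth continuous_on_subset[OF cont]) auto
  then obtain y where y: "dist p y \<le> \<rho>" and min: "\<And>x. dist p x \<le> \<rho> \<Longrightarrow> v y \<le> v x"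
    using continuous_attains_inf[OF compact_cball, of p \<rho> v] \<rho>(1) by auto
  show False
  proof (cases "dist p y < \<rho>")
    case True
    then show False
      using interior min by blast
  next
    \<comment> \<open>On the sphere \<open>v\<close> is at least 0, the value at \<open>p\<close>;
      hence \<open>p\<close> is a minimum too, and it is interior.\<close>
    case False
    then have "v p \<le> v y"
      using \<epsilon>(2)[of y] y \<open>v p = 0\<close> by (simp add: v_def)
    then have "v p \<le> v x" if "dist p x \<le> \<rho>" for x
      using min[OF that] by linarith
    then show False
      using interior[of p] \<rho>(1) by simp
  qed
qed

text \<open>By connectedness, a proper nonempty closed zero set is not open, so some zero
  \<open>a\<close> has non-zeros arbitrarily near. A ball free of zeros, grown about such a non-zero
  until it touches the zero set, gives a contact excluded by
  \<open>no_isolated_contact\<close>.\<close>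

lemma strong_minimum_principle:
  fixes w :: "real^'n::finite \<Rightarrow> real"
  assumes cont: "continuous_on UNIV w" and lap: "\<And>x. has_laplacian w x (l x)"
    and nonneg: "\<And>x. w x \<ge> 0" and "\<delta> > 0" and super: "\<And>x. w x < \<delta> \<Longrightarrow> l x \<le> 0"
    and "w a0 = 0"
  shows "w b = 0"
proof (rule ccontr)
  assume "w b \<noteq> 0"
  define A where "A = {x. w x = 0}"
  have "closed A"
    unfolding A_def by (intro closed_Collect_eq cont continuous_on_const)
  moreover have "A \<noteq> {}" "A \<noteq> UNIV"
    using \<open>w a0 = 0\<close> \<open>w b \<noteq> 0\<close> by (auto simp: A_def)
  ultimately have "\<not> open A"
    using clopen by blast
  then obtain a where a: "a \<in> A" "\<And>r. r > 0 \<Longrightarrow> \<not> ball a r \<subseteq> A"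
    unfolding open_contains_ball by blast
  have "(w \<longlongrightarrow> w a) (nhds a)"
    using cont by (simp add: continuous_on_eq_continuous_at isCont_def tendsto_at_iff_tendsto_nhds)
  then have "\<forall>\<^sub>F x in nhds a. w x < \<delta>"
    by (rule order_tendstoD(2)) (use a(1) \<open>\<delta> > 0\<close> in \<open>simp add: A_def\<close>)
  then obtain r where r: "r > 0" "\<And>x. dist x a < r \<Longrightarrow> w x < \<delta>"
    unfolding eventually_nhds_metric by blast
  then obtain q where q: "dist a q < r / 4" "q \<notin> A"
    using a(2)[of "r / 4"] by (auto simp: subset_iff)
  obtain p where p: "p \<in> A" "\<And>x. x \<in> A \<Longrightarrow> dist q p \<le> dist q x"
    using distance_attains_inf[OF \<open>closed A\<close> \<open>A \<noteq> {}\<close>, of q] by blast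
  \<comment> \<open>The ball about \<open>q\<close> may touch the zero set at several points. The
    ball of half the radius about the midpoint lies inside it and meets its boundary only at
    \<open>p\<close>.\<close>
  define z where "z = midpoint q p"
  have "p \<noteq> q"
    using p(1) q(2) by blast
  define \<rho> where "\<rho> = dist q p / 4"
  have half: "dist z p = dist q p / 2" "dist q z = dist q p / 2"
    by (simp_all add: z_def dist_midpoint)
  have qp: "dist q p < r / 4"
    using p(2)[OF a(1)] q(1) by (simp add: dist_commute)
  show False
  proof (rule no_isolated_contact[OF cont lap nonneg, of p \<rho> z])
    show "w p = 0"
      using p(1) by (simp add: A_def)
    show "0 < \<rho>" "\<rho> < dist z p"
      using \<open>p \<noteq> q\<close> by (auto simp: \<rho>_def half)
    show "l x \<le> 0" if "dist p x \<le> \<rho>" for x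
    proof (rule super, rule r)
      have "dist x a \<le> dist x p + dist p q + dist q a"
        using dist_triangle[of x a p] dist_triangle[of p a q] by linarith
      then show "dist x a < r"
        using that qp q(1) r(1) by (simp add: \<rho>_def dist_commute)
    qed
    show "w x > 0" if "dist z x \<le> dist z p" "x \<noteq> p" for x
    proof -
      \<comment> \<open>Equality in the triangle inequality: a point on both spheres satisfies |X +
        Y| = 2 |Y| and |X| = |Y|, which forces X = Y, that is \<open>x = p\<close>.\<close>
      have "dist q x \<noteq> dist q p \<or> dist z x < dist z p \<or> x = p"
      proof (rule ccontr)
        assume "\<not> ?thesis"
        then have *: "dist q x = dist q p" "dist z x = dist q p / 2" "x \<noteq> p"
          using that(1) half by auto
        define X Y where "X = x - z" and "Y = p - z"
        have "q = z - Y"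
          by (simp add: Y_def z_def midpoint_def vec_eq_iff field_simps)
        then have eqs: "x - q = X + Y" "x - z = X" "x - p = X - Y" "p - q = Y + Y"
          by (auto simp: X_def Y_def)
        have "(x - q) \<bullet> (x - q) = (p - q) \<bullet> (p - q)" "4 * ((x - z) \<bullet> (x - z)) = (p - q) \<bullet> (p - q)"
          unfolding inner_diff_eq_dist_sq *(1,2) by (simp_all add: power_divide)
        then have "(X - Y) \<bullet> (X - Y) = 0"
          unfolding eqs inner_add_left inner_add_right inner_diff_left inner_diff_right
            inner_commute[of Y X] by linarith
        then show False
          using *(3) eqs(3) by simp
      qed
      moreover have "dist q x \<le> dist q z + dist z x"
        by (rule dist_triangle)
      ultimately have "dist q x < dist q p"
        using that half by argo
      then have "x \<notin> A"
        using p(2)[of x] by auto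
      then show ?thesis
        using nonneg[of x] by (simp add: A_def)
    qed
  qed
qed

section \<open>The dichotomy and its application to the equation\<close>

lemma supersolution_dichotomy:
  fixes w :: "real^'n::finite \<Rightarrow> real"
  assumes cont: "continuous_on UNIV w" and lap: "\<And>x. has_laplacian w x (l x)"
    and nonneg: "\<And>x. w x \<ge> 0" and "\<delta> > 0" "c > 0"
    and super: "\<And>x. w x < \<delta> \<Longrightarrow> l x \<le> - c * w x"
  shows "(\<forall>x. w x = 0) \<or> (\<forall>x. w x \<ge> \<delta>)"
proof (cases "\<exists>a. w a = 0")
  case True
  have "l x \<le> 0" if "w x < \<delta>" for x
  proof -
    have "c * w x \<ge> 0"
      using nonneg[of x] \<open>c > 0\<close> by simp
    then show ?thesis
      using super[OF that] by simp
  qed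
  then show ?thesis
    using strong_minimum_principle[OF cont lap nonneg \<open>\<delta> > 0\<close>] True by metis
next
  case False
  then have "w x > 0" for x
    using nonneg[of x] by (metis order_less_le)
  then show ?thesis
    using positive_supersolution_lower_bound[OF cont lap _ \<open>c > 0\<close> super] by blast
qed

lemma Liminf_pos_eventually:
  assumes "Liminf F (\<lambda>s. ereal (g s)) > 0"
  obtains c where "c > 0" "\<forall>\<^sub>F s in F. c < g s"
proof -
  obtain c where "0 < ereal c" "ereal c < Liminf F (\<lambda>s. ereal (g s))"
    using ereal_dense2[OF assms] by blast
  then show thesis
    using that less_LiminfD by force
qed

theorem theorem2p5:
  fixes f :: "real \<Rightarrow> real" and u :: "real^'n \<Rightarrow> real" and \<mu> \<mu>' :: real
  assumes "locally_lipschitz_on {0..} f"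
    and "\<mu> > 0"
    and "\<forall>s\<in>{0<..<\<mu>}. f s > 0"
    and "\<forall>s\<in>{\<mu>..}. f s \<le> 0"
    and "\<mu>' \<in> {0<..<\<mu>}"
    and "antimono_on {\<mu>'..\<mu>} f"
    and "f 0 > 0 \<or> (f 0 = 0 \<and> Liminf (at_right 0) (\<lambda>s. ereal (f s / s)) > 0)"
    and "\<forall>z>\<mu>. f z = 0 \<longrightarrow> Liminf (at_left z) (\<lambda>s. ereal (f s / (s - z))) > 0"
    and "C2 u"
    and "bounded (range u)"
    and "\<forall>x. u x \<ge> 0"
    and "\<forall>x. laplacian u x + f (u x) = 0"
  shows "u constant_on UNIV"
proof -
  have f_cont: "continuous_on {0..} f"
    using assms(1) local_lipschitz_continuous_on[of "{0::real}" "{0..}" "\<lambda>_. f" 0]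
    unfolding locally_lipschitz_on_def by simp
  have f_close: "\<exists>d>0. \<forall>s\<ge>0. \<bar>s - t\<bar> < d \<longrightarrow> \<bar>f s - f t\<bar> < e" if "t \<ge> 0" "e > 0" for t e
    using f_cont that unfolding continuous_on_iff dist_real_def by (auto simp: Ball_def)
  have cont: "continuous_on UNIV u"
    using \<open>C2 u\<close> unfolding C2_def C1_def
    by (meson differentiable_imp_continuous_within continuous_at_imp_continuous_on)
  have lap: "has_laplacian u x (- f (u x))" for x
    using C2_has_laplacian[OF \<open>C2 u\<close>, of x] assms(12) by (metis add.commute add_eq_0_iff minus_minus)
  have bdd: "bdd_below (range u)" "bdd_above (range u)"
    using assms(10) bounded_imp_bdd_below bounded_imp_bdd_above by auto
  \<comment> \<open>Both alternatives of (iii) are reduced to one linear lower bound, which makes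
    \<open>u\<close> a supersolution wherever \<open>u\<close> is below \<delta>.\<close>
  obtain c \<delta> where c\<delta>: "c > 0" "\<delta> > 0" and near0: "\<And>s. 0 \<le> s \<Longrightarrow> s < \<delta> \<Longrightarrow> c * s \<le> f s"
  proof (cases "f 0 > 0")
    case True
    then obtain d where d: "d > 0" "\<And>s. s \<ge> 0 \<Longrightarrow> \<bar>s - 0\<bar> < d \<Longrightarrow> \<bar>f s - f 0\<bar> < f 0 / 2"
      using f_close[of 0 "f 0 / 2"] by auto
    \<comment> \<open>Near 0, \<open>f\<close> exceeds \<open>f 0 / 2\<close> by continuity; capping
      the range at 1 makes the linear function with this slope at most
      \<open>f 0 / 2\<close>.\<close>
    show thesis
    proof (rule that[of "f 0 / 2" "min d 1"])
      show "f 0 / 2 * s \<le> f s" if "0 \<le> s" "s < min d 1" for s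
      proof -
        have "f 0 / 2 * s \<le> f 0 / 2 * 1"
          using that True by (intro mult_left_mono) auto
        moreover have "\<bar>f s - f 0\<bar> < f 0 / 2"
          using d(2)[of s] that by simp
        ultimately show ?thesis
          by linarith
      qed
    qed (use True d in auto)
  next
    case False
    then have f0: "f 0 = 0" and "Liminf (at_right 0) (\<lambda>s. ereal (f s / s)) > 0"
      using assms(7) by auto
    then obtain c where "c > 0" "\<forall>\<^sub>F s in at_right 0. c < f s / s"
      using Liminf_pos_eventually by metis
    then obtain \<delta> where "\<delta> > 0" "\<And>s. 0 < s \<Longrightarrow> s < \<delta> \<Longrightarrow> c < f s / s"
      unfolding eventually_at_right_field by auto
    then show thesis
      using \<open>c > 0\<close> f0
      by (intro that[of c \<delta>]) (auto simp: pos_less_divide_eq order_le_less)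
  qed
  have "(\<forall>x. u x = 0) \<or> (\<forall>x. u x \<ge> \<delta>)"
    by (rule supersolution_dichotomy[OF cont lap _ c\<delta>(2,1)]) (use assms(11) near0 in auto)
  then show ?thesis
  proof
    assume "\<forall>x. u x = 0"
    then show ?thesis
      unfolding constant_on_def by blast
  next
    assume u\<delta>: "\<forall>x. u x \<ge> \<delta>"
    define m where "m = Inf (range u)"
    define M where "M = Sup (range u)"
    have m: "m \<le> u x" and M: "u x \<le> M" for x
      using bdd by (simp_all add: m_def M_def cInf_lower cSup_upper)
    have "m \<ge> \<delta>"
      unfolding m_def using u\<delta> by (intro cInf_greatest) auto
    \<comment> \<open>Any single point, here \<open>undefined\<close>, yields
      \<open>m \<le> M\<close>.\<close>
    then have "m > 0" "M > 0"
      using c\<delta>(2) m[of undefined] M[of undefined] by auto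
    have "f m \<le> 0"
    proof (rule ccontr)
      assume "\<not> f m \<le> 0"
      then obtain d where d: "d > 0" "\<And>s. s \<ge> 0 \<Longrightarrow> \<bar>s - m\<bar> < d \<Longrightarrow> \<bar>f s - f m\<bar> < f m / 2"
        using f_close[of m "f m / 2"] \<open>m > 0\<close> by auto
      \<comment> \<open>An almost minimal \<open>y\<close> gives
        \<open>f (u y) \<le> f m / 3\<close>, while continuity at \<open>m\<close> gives
        \<open>f (u y) > f m / 2\<close>.\<close>
      define \<epsilon> where "\<epsilon> = min d (f m / 3)"
      have \<epsilon>: "\<epsilon> > 0" "\<epsilon> \<le> d" "\<epsilon> \<le> f m / 3"
        using d(1) \<open>\<not> f m \<le> 0\<close> by (auto simp: \<epsilon>_def)
      obtain y where "u y < m + \<epsilon>" "- f (u y) \<ge> - \<epsilon>"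
        using almost_minimum_laplacian[OF cont lap bdd(1) \<epsilon>(1)] m_def by blast
      then show False
        using d(2)[of "u y"] assms(11) m[of y] \<epsilon> \<open>\<not> f m \<le> 0\<close> by (auto simp: abs_less_iff)
    qed
    then have "m \<ge> \<mu>"
      using assms(3) \<open>m > 0\<close> by (meson greaterThanLessThan_iff not_less)
    show ?thesis
    proof (cases "M \<le> \<mu>")
      case True
      then have "u x = \<mu>" for x
        using m[of x] M[of x] \<open>m \<ge> \<mu>\<close> by linarith
      then show ?thesis
        unfolding constant_on_def by blast
    next
      case False
      \<comment> \<open>This is \<open>M - u\<close>, spelled so that
        \<open>has_laplacian_linear\<close> matches.\<close>
      define w where "w = (\<lambda>x. M * 1 + (-1) * u x)"
      have w_cont: "continuous_on UNIV w"
        unfolding w_def by (intro continuous_intros cont)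
      have w_lap: "has_laplacian w x (f (u x))" for x
        using has_laplacian_linear[OF has_laplacian_const[of 1 x] lap[of x], of M "-1"]
        by (simp add: w_def)
      have w_nonneg: "w x \<ge> 0" for x
        using M by (simp add: w_def)
      have w_small: "\<exists>x. w x < e" if "e > 0" for e
      proof -
        have "M - e < Sup (range u)"
          using that by (simp add: M_def)
        then obtain x where "M - e < u x"
          using less_cSupD[of "range u" "M - e"] by auto
        then show ?thesis
          by (intro exI[of _ x]) (simp add: w_def)
      qed
      have w_bdd: "bdd_below (range w)"
        using w_nonneg by (intro bdd_belowI[of _ 0]) auto
      have w_Inf: "Inf (range w) \<le> 0"
        using w_small[of "Inf (range w)"] cInf_lower[OF rangeI w_bdd] by (meson not_less)
      have "f M \<ge> 0"
      proof (rule ccontr)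
        assume "\<not> f M \<ge> 0"
        then obtain d where d: "d > 0" "\<And>s. s \<ge> 0 \<Longrightarrow> \<bar>s - M\<bar> < d \<Longrightarrow> \<bar>f s - f M\<bar> < - f M / 2"
          using f_close[of M "- f M / 2"] \<open>M > 0\<close> by auto
        define \<epsilon> where "\<epsilon> = min d (- f M / 3)"
        have \<epsilon>: "\<epsilon> > 0" "\<epsilon> \<le> d" "\<epsilon> \<le> - f M / 3"
          using d(1) \<open>\<not> f M \<ge> 0\<close> by (auto simp: \<epsilon>_def)
        obtain y where "w y < Inf (range w) + \<epsilon>" "f (u y) \<ge> - \<epsilon>"
          using almost_minimum_laplacian[OF w_cont w_lap w_bdd \<epsilon>(1)] by blast
        then show False
          using d(2)[of "u y"] assms(11) M[of y] \<epsilon> \<open>\<not> f M \<ge> 0\<close> w_Inf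
          by (auto simp: abs_less_iff w_def)
      qed
      then have fM: "f M = 0"
        using assms(4)[rule_format, of M] False by simp
      then obtain k where "k > 0" "\<forall>\<^sub>F s in at_left M. k < f s / (s - M)"
        using Liminf_pos_eventually assms(8) False by (metis not_le)
      then obtain b where b: "b < M" "\<And>s. b < s \<Longrightarrow> s < M \<Longrightarrow> k < f s / (s - M)"
        unfolding eventually_at_left_field by auto
      \<comment> \<open>Multiplying by \<open>s - M\<close>, which is negative, reverses the bound
        on the quotient. The value \<open>s = M\<close>, about which the left limit says nothing, is
        covered by \<open>fM\<close>.\<close>
      have "f (u x) \<le> - k * w x" if "w x < M - b" for x
      proof (cases "u x = M")
        case True
        then show ?thesis
          by (simp add: fM w_def)
      next
        case False
        then have "u x < M"
          using M[of x] by simp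
        then show ?thesis
          using b(2)[of "u x"] that by (simp add: w_def neg_less_divide_eq algebra_simps)
      qed
      then have "(\<forall>x. w x = 0) \<or> (\<forall>x. w x \<ge> M - b)"
        using b(1) by (intro supersolution_dichotomy[OF w_cont w_lap w_nonneg _ \<open>k > 0\<close>]) auto
      \<comment> \<open>As \<open>M\<close> is the supremum of \<open>u\<close>, \<open>w\<close>
        takes values below \<open>M - b\<close>, which rules out the second alternative.\<close>
      then have "\<forall>x. w x = 0"
        using w_small[of "M - b"] b(1) by (meson diff_gt_0_iff_gt not_less)
      then have "u x = M" for x
        by (simp add: w_def)
      then show ?thesis
        unfolding constant_on_def by blast
    qed
  qed
qed

end
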